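(* Let $G$ be a finite nilpotent group which is not a $p$-group for any prime $p$. The graph $\Gamma_{CCC}(G)$ is both a cograph and a chordal graph if one of the following holds: (i) $G$ is abelian; or (ii) $G$ is non-abelian and possesses a unique non-abelian Sylow subgroup $P$, all other Sylow subgroups of $G$ being abelian, and the commuting conjugacy class graph $\Gamma_{CCC}(P)$ of this non-abelian Sylow subgroup is both a cograph and a chordal graph.
   Context: All groups are finite. For a finite group $G$, the commuting conjugacy class graph $\Gamma_{CCC}(G)$ is the simple graph whose vertices are the non-central conjugacy classes of $G$ (the classes $x^G$ with $x\notin Z(G)$), two distinct vertices $x^G$ and $y^G$ being adjacent if and only if there exist $a\in x^G$ and $b\in y^G$ such that $\langle a,b\rangle$ is abelian. A graph is a cograph if it has no induced subgraph isomorphic to the path $P_4$ on four vertices. A graph is chordal if it has no induced cycle $C_n$ with $n\ge 4$. *)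

theory Defs
  imports "HOL-Algebra.Generated_Groups" "HOL-Algebra.Sylow" "Graph_Theory.Graph_Theory"
begin

definition group_center :: "('a, 'b) monoid_scheme \<Rightarrow> 'a set" where
  "group_center G = {z \<in> carrier G. \<forall>g \<in> carrier G. g \<otimes>\<^bsub>G\<^esub> z = z \<otimes>\<^bsub>G\<^esub> g}"

definition conj_class :: "('a, 'b) monoid_scheme \<Rightarrow> 'a \<Rightarrow> 'a set" where
  "conj_class G x = {inv\<^bsub>G\<^esub> g \<otimes>\<^bsub>G\<^esub> x \<otimes>\<^bsub>G\<^esub> g | g. g \<in> carrier G}"

text \<open>The subgroup generated by all commutators \<open>[h, k]\<close> with \<open>h\<close> in \<open>H\<close> and \<open>k\<close> in \<open>K\<close>;
  the commutator convention is the one of \<^const>\<open>derived\<close>.\<close>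

definition commutator_subgroup :: "('a, 'b) monoid_scheme \<Rightarrow> 'a set \<Rightarrow> 'a set \<Rightarrow> 'a set" where
  "commutator_subgroup G H K =
     generate G (\<Union>h\<in>H. \<Union>k\<in>K. {h \<otimes>\<^bsub>G\<^esub> k \<otimes>\<^bsub>G\<^esub> inv\<^bsub>G\<^esub> h \<otimes>\<^bsub>G\<^esub> inv\<^bsub>G\<^esub> k})"

fun lower_central_series :: "('a, 'b) monoid_scheme \<Rightarrow> nat \<Rightarrow> 'a set" where
  "lower_central_series G 0 = carrier G"
| "lower_central_series G (Suc n) =
     commutator_subgroup G (lower_central_series G n) (carrier G)"

definition nilpotent_group :: "('a, 'b) monoid_scheme \<Rightarrow> bool" where
  "nilpotent_group G \<longleftrightarrow> group G \<and> (\<exists>n. lower_central_series G n = {\<one>\<^bsub>G\<^esub>})"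

text \<open>Finite \<open>p\<close>-groups. The trivial group is a \<open>p\<close>-group for every \<open>p\<close>.\<close>

definition p_group :: "nat \<Rightarrow> ('a, 'b) monoid_scheme \<Rightarrow> bool" where
  "p_group p G \<longleftrightarrow> group G \<and> prime p \<and> (\<exists>n. order G = p ^ n)"

text \<open>For a prime \<open>p\<close> not dividing the order of \<open>G\<close>, the Sylow \<open>p\<close>-subgroup is trivial.\<close>

definition sylow_subgroup :: "('a, 'b) monoid_scheme \<Rightarrow> nat \<Rightarrow> 'a set \<Rightarrow> bool" where
  "sylow_subgroup G p P \<longleftrightarrow>
     prime p \<and> subgroup P G \<and> card P = p ^ multiplicity p (order G)"

text \<open>Simple graphs are represented by loop-free symmetric relations, see \<^locale>\<open>pair_graph\<close>.\<close>

definition ccc_graph :: "('a, 'b) monoid_scheme \<Rightarrow> 'a set pair_pre_digraph" where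
  "ccc_graph G =
     (let V = {conj_class G x | x. x \<in> carrier G - group_center G}
      in \<lparr> pverts = V,
           parcs = {(A, B). A \<in> V \<and> B \<in> V \<and> A \<noteq> B \<and>
                      (\<exists>a \<in> A. \<exists>b \<in> B. comm_group (subgroup_generated G {a, b}))} \<rparr>)"

definition path_graph :: "nat \<Rightarrow> nat pair_pre_digraph" where
  "path_graph n =
     \<lparr> pverts = {..<n},
       parcs = {(i, j). i < n \<and> j < n \<and> (j = Suc i \<or> i = Suc j)} \<rparr>"

text \<open>Intended for \<open>n \<ge> 3\<close> only.\<close>

definition cycle_graph :: "nat \<Rightarrow> nat pair_pre_digraph" where
  "cycle_graph n =
     \<lparr> pverts = {..<n},
       parcs = {(i, j). i < n \<and> j < n \<and> (j = Suc i mod n \<or> i = Suc j mod n)} \<rparr>"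

definition contains_induced :: "'v pair_pre_digraph \<Rightarrow> 'w pair_pre_digraph \<Rightarrow> bool" where
  "contains_induced \<Gamma> H \<longleftrightarrow>
     (\<exists>W \<subseteq> pverts \<Gamma>. digraph_iso (with_proj H) (with_proj \<Gamma> \<restriction> W))"

definition cograph :: "'v pair_pre_digraph \<Rightarrow> bool" where
  "cograph \<Gamma> \<longleftrightarrow> \<not> contains_induced \<Gamma> (path_graph 4)"

definition chordal :: "'v pair_pre_digraph \<Rightarrow> bool" where
  "chordal \<Gamma> \<longleftrightarrow> (\<forall>n \<ge> 4. \<not> contains_induced \<Gamma> (cycle_graph n))"

lemma pair_graph_ccc_graph:
  assumes "finite (carrier G)"
  shows "pair_graph (ccc_graph G)"
proof -
  let ?V = "{conj_class G x | x. x \<in> carrier G - group_center G}"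
  have "?V = conj_class G ` (carrier G - group_center G)" by auto
  then have fin: "finite ?V" using assms by simp
  have "finite (parcs (ccc_graph G))"
    by (rule finite_subset[of _ "?V \<times> ?V"]) (use fin in \<open>auto simp: ccc_graph_def Let_def\<close>)
  moreover have "sym (parcs (ccc_graph G))"
  proof (rule symI)
    fix A B assume AB: "(A, B) \<in> parcs (ccc_graph G)"
    then obtain a b where "a \<in> A" "b \<in> B" "comm_group (subgroup_generated G {b, a})"
      by (auto simp: ccc_graph_def Let_def insert_commute)
    then have "\<exists>b\<in>B. \<exists>a\<in>A. comm_group (subgroup_generated G {b, a})" by blast
    then show "(B, A) \<in> parcs (ccc_graph G)"
      using AB not_sym[of A B] by (simp add: ccc_graph_def Let_def)
  qed
  ultimately show ?thesis
    using fin by unfold_locales (auto simp: ccc_graph_def Let_def symmetric_def)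
qed

lemma pair_graph_path_graph: "pair_graph (path_graph n)"
proof -
  have "finite (parcs (path_graph n))"
    by (rule finite_subset[of _ "{..<n} \<times> {..<n}"]) (auto simp: path_graph_def)
  then show ?thesis
    by unfold_locales (auto simp: path_graph_def symmetric_def sym_def)
qed

lemma pair_graph_cycle_graph:
  assumes "n \<ge> 3"
  shows "pair_graph (cycle_graph n)"
proof -
  have "finite (parcs (cycle_graph n))"
    by (rule finite_subset[of _ "{..<n} \<times> {..<n}"]) (auto simp: cycle_graph_def)
  moreover have ne: "Suc i mod n \<noteq> i" if "i < n" for i
    using assms that by (cases "Suc i = n") auto
  moreover have "i \<noteq> Suc i mod n" if "i < n" for i
    using ne[OF that] by (rule not_sym)
  ultimately show ?thesis
    by unfold_locales (auto simp: cycle_graph_def symmetric_def sym_def)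
qed

text \<open>An isomorphism onto an induced subgraph is the same as an injective map of the vertices
  that preserves and reflects adjacency.\<close>

lemma contains_induced_iff:
  assumes "pair_wf_digraph H"
  shows "contains_induced \<Gamma> H \<longleftrightarrow>
    (\<exists>f. inj_on f (pverts H) \<and> f ` pverts H \<subseteq> pverts \<Gamma> \<and>
       (\<forall>u \<in> pverts H. \<forall>v \<in> pverts H. (u, v) \<in> parcs H \<longleftrightarrow> (f u, f v) \<in> parcs \<Gamma>))"
    (is "?L \<longleftrightarrow> (\<exists>f. ?P f)")
proof
  interpret H: pair_wf_digraph H by fact
  assume ?L
  then obtain W h where W: "W \<subseteq> pverts \<Gamma>"
    and h: "pre_digraph.digraph_isomorphism (with_proj H) h"
    and eq: "with_proj \<Gamma> \<restriction> W = app_iso h (with_proj H)"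
    by (auto simp: contains_induced_def digraph_iso_def)
  have V: "iso_verts h ` pverts H = W" using arg_cong[OF eq, of verts] by simp
  have A: "iso_arcs h ` parcs H = {e \<in> parcs \<Gamma>. fst e \<in> W \<and> snd e \<in> W}"
    using arg_cong[OF eq, of arcs] by simp
  have T: "iso_tail h = fst" using arg_cong[OF eq, of tail] by simp
  have D: "iso_head h = snd" using arg_cong[OF eq, of head] by simp
  have inj: "inj_on (iso_verts h) (pverts H)"
    and ends: "\<And>a. a \<in> parcs H \<Longrightarrow> iso_arcs h a = (iso_verts h (fst a), iso_verts h (snd a))"
    using h by (auto simp: pre_digraph.digraph_isomorphism_def T D prod_eq_iff)
  have "(u, v) \<in> parcs H \<longleftrightarrow> (iso_verts h u, iso_verts h v) \<in> parcs \<Gamma>"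
    if uv: "u \<in> pverts H" "v \<in> pverts H" for u v
  proof
    assume "(u, v) \<in> parcs H"
    then show "(iso_verts h u, iso_verts h v) \<in> parcs \<Gamma>"
      using A ends[of "(u, v)"] by (metis (no_types, lifting) fst_conv snd_conv imageI mem_Collect_eq)
  next
    assume "(iso_verts h u, iso_verts h v) \<in> parcs \<Gamma>"
    then have "(iso_verts h u, iso_verts h v) \<in> iso_arcs h ` parcs H"
      using A V uv by auto
    then obtain a where a: "a \<in> parcs H"
      and "iso_verts h (fst a) = iso_verts h u" "iso_verts h (snd a) = iso_verts h v"
      using ends by auto
    then have "fst a = u" "snd a = v"
      using inj uv H.arc_fst_in_verts[OF a] H.arc_snd_in_verts[OF a] by (auto dest: inj_onD)
    then show "(u, v) \<in> parcs H" using a by auto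
  qed
  then show "\<exists>f. ?P f" using inj V W by blast
next
  interpret H: pair_wf_digraph H by fact
  assume "\<exists>f. ?P f"
  then obtain f where inj: "inj_on f (pverts H)" and sub: "f ` pverts H \<subseteq> pverts \<Gamma>"
    and adj: "\<And>u v. u \<in> pverts H \<Longrightarrow> v \<in> pverts H \<Longrightarrow>
      (u, v) \<in> parcs H \<longleftrightarrow> (f u, f v) \<in> parcs \<Gamma>"
    by blast
  define h where "h = \<lparr> iso_verts = f, iso_arcs = map_prod f f, iso_head = snd, iso_tail = fst \<rparr>"
  have "parcs H \<subseteq> pverts H \<times> pverts H" by (auto dest: H.wellformed')
  then have "inj_on (map_prod f f) (parcs H)"
    by (rule inj_on_subset[OF map_prod_inj_on[OF inj inj]])
  then have "pre_digraph.digraph_isomorphism (with_proj H) h"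
    using inj by (auto simp: pre_digraph.digraph_isomorphism_def h_def H.wf_digraph_axioms)
  moreover have "map_prod f f ` parcs H = {e \<in> parcs \<Gamma>. fst e \<in> f ` pverts H \<and> snd e \<in> f ` pverts H}"
  proof (intro Set.set_eqI iffI)
    fix e assume "e \<in> map_prod f f ` parcs H"
    then obtain u v where "(u, v) \<in> parcs H" "e = (f u, f v)" by auto
    then show "e \<in> {e \<in> parcs \<Gamma>. fst e \<in> f ` pverts H \<and> snd e \<in> f ` pverts H}"
      using adj[of u v] H.in_arcsD1[of u v] H.in_arcsD2[of u v] by simp
  next
    fix e assume "e \<in> {e \<in> parcs \<Gamma>. fst e \<in> f ` pverts H \<and> snd e \<in> f ` pverts H}"
    then obtain u v where "u \<in> pverts H" "v \<in> pverts H" "e = (f u, f v)" "e \<in> parcs \<Gamma>"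
      by (cases e) auto
    then have "(u, v) \<in> parcs H" "e = map_prod f f (u, v)" using adj by auto
    then show "e \<in> map_prod f f ` parcs H" by blast
  qed
  then have "with_proj \<Gamma> \<restriction> (f ` pverts H) = app_iso h (with_proj H)"
    by (simp add: app_iso_def h_def induce_subgraph_def)
  ultimately show ?L
    using sub by (auto simp: contains_induced_def digraph_iso_def)
qed

end

theory Submission
  imports Defs "HOL-Algebra.SndIsomorphismGrp" "HOL-Algebra.Multiplicative_Group"
begin

text \<open>In a nilpotent group, elements of coprime orders commute
  (\<open>nilpotent_coprime_commute\<close>). An abelian Sylow subgroup therefore commutes with every Sylow
  subgroup, itself included, and hence is central. If \<open>P\<close> is the only non-abelian Sylow
  subgroup, then \<open>Z(G) P\<close> contains a Sylow subgroup for every prime, so \<open>G = Z(G) P\<close>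
  (\<open>nilpotent_unique_nonabelian_sylow\<close>).

  It follows that each class of \<open>G\<close> has the form \<open>z D\<close> with \<open>z\<close> central in \<open>G\<close> and \<open>D\<close> a
  class of \<open>P\<close>, and central factors do not affect whether two elements commute. The graph of
  \<open>G\<close> is thus obtained from the graph of \<open>P\<close> by replacing vertices with cliques:
  \<open>z D \<mapsto> D\<close> preserves and reflects the relation \<open>equal or adjacent\<close>
  (\<open>ccc_graph_projection\<close>).

  Two vertices with the same image have the same closed neighbourhood. Neither the path on four
  vertices nor a cycle of length at least four has two such vertices, so the projection maps an
  induced copy of either graph injectively to an induced copy in the graph of \<open>P\<close>
  (\<open>contains_induced_projection\<close>). An abelian group has no non-central classes, and its graph
  is empty.\<close>

section \<open>The centre\<close>

context group
begin

lemma inv_mult_cancel_left: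
  assumes "a \<in> carrier G" "b \<in> carrier G"
  shows "inv a \<otimes> (a \<otimes> b) = b" and "a \<otimes> (inv a \<otimes> b) = b"
  using assms by (simp_all flip: m_assoc)

lemma centralizer_subgroup:
  assumes "S \<subseteq> carrier G"
  shows "subgroup {g \<in> carrier G. \<forall>s\<in>S. g \<otimes> s = s \<otimes> g} G"
proof (rule subgroupI)
  fix g assume g: "g \<in> {g \<in> carrier G. \<forall>s\<in>S. g \<otimes> s = s \<otimes> g}"
  have "inv g \<otimes> s = s \<otimes> inv g" if "s \<in> S" for s
  proof -
    have s: "s \<in> carrier G" using assms that by blast
    have "inv g \<otimes> s = inv g \<otimes> (s \<otimes> g) \<otimes> inv g"
      using g s by (simp add: m_assoc)
    also have "\<dots> = inv g \<otimes> (g \<otimes> s) \<otimes> inv g" using g that by simp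
    also have "\<dots> = s \<otimes> inv g" using g s by (simp add: m_assoc[symmetric])
    finally show ?thesis .
  qed
  then show "inv g \<in> {g \<in> carrier G. \<forall>s\<in>S. g \<otimes> s = s \<otimes> g}" using g by simp
next
  fix g h
  assume g: "g \<in> {g \<in> carrier G. \<forall>s\<in>S. g \<otimes> s = s \<otimes> g}"
    and h: "h \<in> {g \<in> carrier G. \<forall>s\<in>S. g \<otimes> s = s \<otimes> g}"
  have "g \<otimes> h \<otimes> s = s \<otimes> (g \<otimes> h)" if "s \<in> S" for s
  proof -
    have s: "s \<in> carrier G" using assms that by blast
    have "g \<otimes> h \<otimes> s = g \<otimes> (s \<otimes> h)" using g h s that by (simp add: m_assoc)
    also have "\<dots> = s \<otimes> g \<otimes> h" using g h s that by (simp add: m_assoc[symmetric])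
    finally show ?thesis using g h s by (simp add: m_assoc)
  qed
  then show "g \<otimes> h \<in> {g \<in> carrier G. \<forall>s\<in>S. g \<otimes> s = s \<otimes> g}" using g h by simp
qed (use assms in \<open>auto simp: subset_iff intro!: exI[of _ "\<one>"]\<close>)

lemma group_center_normal: "group_center G \<lhd> G"
proof (rule normal_invI)
  have "group_center G = {g \<in> carrier G. \<forall>s\<in>carrier G. g \<otimes> s = s \<otimes> g}"
    by (auto simp: group_center_def)
  then show "subgroup (group_center G) G"
    using centralizer_subgroup[of "carrier G"] by simp
next
  fix g z assume g: "g \<in> carrier G" and z: "z \<in> group_center G"
  have "g \<otimes> z \<otimes> inv g = z \<otimes> g \<otimes> inv g" using g z by (simp add: group_center_def)
  also have "\<dots> = z" using g z by (simp add: group_center_def m_assoc)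
  finally show "g \<otimes> z \<otimes> inv g \<in> group_center G" using z by simp
qed

section \<open>Elements of coprime orders in a nilpotent group\<close>

lemma pow_central_commutator:
  assumes "x \<in> carrier G" "y \<in> carrier G" "c \<in> group_center G"
    and "x \<otimes> y = c \<otimes> (y \<otimes> x)"
  shows "x \<otimes> y [^] (k::nat) = c [^] k \<otimes> (y [^] k \<otimes> x)"
proof (induction k)
  case 0
  then show ?case using assms by simp
next
  case (Suc k)
  have c: "c \<in> carrier G" and cc: "\<And>g. g \<in> carrier G \<Longrightarrow> g \<otimes> c = c \<otimes> g"
    using assms(3) by (auto simp: group_center_def)
  have "x \<otimes> y [^] Suc k = (c [^] k \<otimes> (y [^] k \<otimes> x)) \<otimes> y"
    using assms by (simp add: m_assoc[symmetric] Suc)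
  also have "\<dots> = c [^] k \<otimes> (y [^] k \<otimes> (c \<otimes> (y \<otimes> x)))"
    using assms c by (simp add: m_assoc)
  also have "y [^] k \<otimes> (c \<otimes> (y \<otimes> x)) = (c \<otimes> y [^] k) \<otimes> (y \<otimes> x)"
    using assms c cc[of "y [^] k"] by (simp add: m_assoc[symmetric])
  also have "c [^] k \<otimes> \<dots> = c [^] Suc k \<otimes> (y [^] Suc k \<otimes> x)"
    using assms c by (simp add: m_assoc)
  finally show ?case .
qed

text \<open>When the commutator \<open>c\<close> of \<open>x\<close> and \<open>y\<close> is central, the commutator of \<open>x\<close> and
  \<open>y\<^sup>n\<close> is \<open>c\<^sup>n\<close>.\<close>

lemma pow_central_commutator_eq_one:
  assumes "x \<in> carrier G" "y \<in> carrier G" "c \<in> group_center G"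
    and "x \<otimes> y = c \<otimes> (y \<otimes> x)" and "y [^] (n::nat) = \<one>"
  shows "c [^] n = \<one>"
proof -
  have c: "c \<in> carrier G" using assms(3) by (simp add: group_center_def)
  have "x = c [^] n \<otimes> x"
    using pow_central_commutator[OF assms(1-4), of n] assms c by simp
  then show ?thesis using assms(1) c by (metis nat_pow_closed r_cancel_one')
qed

text \<open>The order of \<open>c\<close> divides \<open>n\<close> by the preceding lemma, and it divides \<open>m\<close> because
  exchanging \<open>x\<close> and \<open>y\<close> inverts the commutator.\<close>

lemma central_commutator_coprime:
  assumes "x \<in> carrier G" "y \<in> carrier G" and c: "c \<in> group_center G"
    and eq: "x \<otimes> y = c \<otimes> (y \<otimes> x)"
    and "x [^] (m::nat) = \<one>" "y [^] (n::nat) = \<one>" "coprime m n"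
  shows "c = \<one>"
proof -
  interpret Z: normal "group_center G" G by (rule group_center_normal)
  have cc: "c \<in> carrier G" using c by (simp add: Z.subset)
  have "c [^] n = \<one>" 
    by (rule pow_central_commutator_eq_one[OF assms(1-4) assms(6)])
  moreover have "c [^] m = \<one>"
  proof -
    have "y \<otimes> x = inv c \<otimes> (x \<otimes> y)"
      using assms(1,2) cc by (simp add: eq m_assoc[symmetric])
    then have "inv c [^] m = \<one>"
      by (rule pow_central_commutator_eq_one[OF assms(2,1) Z.m_inv_closed[OF c] _ assms(5)])
    then show ?thesis using cc by (simp add: nat_pow_inv)
  qed
  ultimately have "ord c dvd m" "ord c dvd n" using cc by (simp_all add: pow_eq_id)
  then have "ord c = 1" using \<open>coprime m n\<close> coprime_common_divisor_nat by blast
  then show ?thesis using cc by (metis nat_pow_eone pow_ord_eq_1)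
qed

lemma lower_central_series_normal: "lower_central_series G i \<lhd> G"
proof (induction i)
  case 0
  show ?case by (simp add: normal_inv_iff subgroup_self)
next
  case (Suc i)
  interpret N: normal "lower_central_series G i" G by (rule Suc)
  let ?C = "\<Union>h\<in>lower_central_series G i. \<Union>k\<in>carrier G. {h \<otimes> k \<otimes> inv h \<otimes> inv k}"
  have "generate G ?C \<lhd> G"
  proof (rule normal_generateI)
    show "?C \<subseteq> carrier G" using N.subset by auto
    fix x g assume "x \<in> ?C" and g: "g \<in> carrier G"
    then obtain h k where h: "h \<in> lower_central_series G i" and k: "k \<in> carrier G"
      and x: "x = h \<otimes> k \<otimes> inv h \<otimes> inv k" by blast
    have hc: "h \<in> carrier G" using h N.subset by blast
    let ?h = "g \<otimes> h \<otimes> inv g" and ?k = "g \<otimes> k \<otimes> inv g"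
    have "g \<otimes> x \<otimes> inv g = ?h \<otimes> ?k \<otimes> inv ?h \<otimes> inv ?k"
      using g k hc by (simp add: x inv_mult_group m_assoc inv_mult_cancel_left)
    moreover have "?h \<in> lower_central_series G i" using N.inv_op_closed2 g h by blast
    moreover have "?k \<in> carrier G" using g k by simp
    ultimately show "g \<otimes> x \<otimes> inv g \<in> ?C" by blast
  qed
  then show ?case by (simp add: commutator_subgroup_def)
qed

text \<open>The commutator \<open>c\<close> of \<open>x\<close> and \<open>y\<close> descends through the lower central series: if it
  lies in one term, then it is central modulo the next term, and the coprime orders of the
  images of \<open>x\<close> and \<open>y\<close> make it trivial there.\<close>

lemma nilpotent_coprime_commute:
  assumes "nilpotent_group G" and x: "x \<in> carrier G" and y: "y \<in> carrier G"
    and "x [^] (m::nat) = \<one>" "y [^] (n::nat) = \<one>" "coprime m n"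
  shows "x \<otimes> y = y \<otimes> x"
proof -
  define c where "c = x \<otimes> y \<otimes> inv x \<otimes> inv y"
  have c: "c \<in> carrier G" using x y by (simp add: c_def)
  have xy: "x \<otimes> y = c \<otimes> (y \<otimes> x)" using x y by (simp add: c_def m_assoc inv_solve_left')
  have "c \<in> lower_central_series G i" for i
  proof (induction i)
    case 0
    show ?case using c by simp
  next
    case (Suc i)
    define N where "N = lower_central_series G (Suc i)"
    interpret N: normal N G unfolding N_def by (rule lower_central_series_normal)
    interpret Q: group "G Mod N" by (rule N.factorgroup_is_group)
    define h where "h = (\<lambda>a. N #> a)"
    interpret h: group_hom G "G Mod N" h
      by unfold_locales (simp add: h_def N.r_coset_hom_Mod)
    have hN: "h a = \<one>\<^bsub>G Mod N\<^esub>" if "a \<in> N" for a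
      using that by (simp add: h_def N.rcos_const FactGroup_def)
    have "h c \<in> group_center (G Mod N)"
    proof -
      have "X \<otimes>\<^bsub>G Mod N\<^esub> h c = h c \<otimes>\<^bsub>G Mod N\<^esub> X"
        if XQ: "X \<in> carrier (G Mod N)" for X
      proof -
        obtain g where g: "g \<in> carrier G" and X: "X = h g"
          using XQ by (auto simp: FactGroup_def RCOSETS_def h_def)
        let ?d = "c \<otimes> g \<otimes> inv c \<otimes> inv g"
        \<comment> \<open>As \<open>c\<close> lies in term \<open>i\<close>, its commutator with any \<open>g\<close> lies in \<open>N\<close>.\<close>
        have "?d \<in> N"
          unfolding N_def lower_central_series.simps commutator_subgroup_def
          using Suc g by (intro generate.incl) blast
        moreover have "c \<otimes> g = ?d \<otimes> (g \<otimes> c)"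
          using c g by (simp add: m_assoc inv_solve_left')
        ultimately have "h (c \<otimes> g) = h (g \<otimes> c)"
          using c g by (metis hN N.mem_carrier h.hom_mult h.hom_closed m_closed Q.l_one)
        then show ?thesis using c g X by simp
      qed
      then show ?thesis using c by (simp add: group_center_def)
    qed
    then have "h c = \<one>\<^bsub>G Mod N\<^esub>"
    proof (rule Q.central_commutator_coprime[rotated 2])
      show "h x \<otimes>\<^bsub>G Mod N\<^esub> h y = h c \<otimes>\<^bsub>G Mod N\<^esub> (h y \<otimes>\<^bsub>G Mod N\<^esub> h x)"
        using arg_cong[OF xy, of h] x y c by simp
      show "h x [^]\<^bsub>G Mod N\<^esub> m = \<one>\<^bsub>G Mod N\<^esub>" "h y [^]\<^bsub>G Mod N\<^esub> n = \<one>\<^bsub>G Mod N\<^esub>"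
        using assms by (simp_all flip: h.hom_nat_pow)
    qed (use x y assms in auto)
    then have "N #> c = N" by (simp add: h_def FactGroup_def)
    then have "c \<in> N" using c N.subgroup_axioms by (rule coset_join1)
    then show ?case unfolding N_def .
  qed
  moreover obtain i where "lower_central_series G i = {\<one>}"
    using assms(1) by (auto simp: nilpotent_group_def)
  ultimately have "c = \<one>" by blast
  then show ?thesis using xy x y by simp
qed

section \<open>Splitting off the abelian Sylow subgroups\<close>

lemma sylow_subgroup_exists:
  assumes "finite (carrier G)" "prime p"
  shows "\<exists>P. sylow_subgroup G p P"
proof -
  obtain m where "order G = p ^ multiplicity p (order G) * m"
    using multiplicity_dvd[of p "order G"] by blast
  then show ?thesis
    using sylow_thm[OF assms(2) group_axioms _ assms(1)] assms(2) by (auto simp: sylow_subgroup_def)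
qed

text \<open>By Lagrange, the order of such a subgroup is divisible by every prime power that exactly
  divides the order of the group.\<close>

lemma subgroup_containing_sylows:
  assumes fin: "finite (carrier G)" and H: "subgroup H G"
    and "\<And>p. prime p \<Longrightarrow> \<exists>P \<subseteq> H. sylow_subgroup G p P"
  shows "H = carrier G"
proof -
  have HG: "H \<subseteq> carrier G" using H by (rule subgroup.subset)
  have ord0: "order G \<noteq> 0" using fin order_gt_0_iff_finite by simp
  have "finite H" using HG fin finite_subset by blast
  have cardH: "card H \<noteq> 0" using \<open>finite H\<close> subgroup.one_closed[OF H] by auto
  have "order G dvd card H"
  proof (rule multiplicity_le_imp_dvd[OF ord0])
    fix p :: nat assume p: "prime p"
    obtain P where "P \<subseteq> H" "sylow_subgroup G p P" using assms(3)[OF p] by blast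
    then have "subgroup P (G\<lparr>carrier := H\<rparr>)" and "card P = p ^ multiplicity p (order G)"
      using H by (auto simp: sylow_subgroup_def intro: subgroup_incl)
    then have "p ^ multiplicity p (order G) dvd order (G\<lparr>carrier := H\<rparr>)"
      using group.lagrange[OF subgroup_imp_group[OF H], of P] dvd_triv_right by metis
    then have "p ^ multiplicity p (order G) dvd card H" by (simp add: order_def)
    then show "multiplicity p (order G) \<le> multiplicity p (card H)"
      using cardH p by (intro multiplicity_geI) (auto simp: prime_gt_1_nat)
  qed
  then have "card (carrier G) \<le> card H" using cardH by (simp add: order_def dvd_imp_le)
  then show ?thesis using card_seteq[OF fin HG] by blast
qed

lemma sylow_pow_eq_one:
  assumes "sylow_subgroup G p P" "x \<in> P"
  shows "x [^] (p ^ multiplicity p (order G)) = \<one>"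
proof -
  have P: "subgroup P G" and card: "card P = p ^ multiplicity p (order G)"
    using assms(1) by (auto simp: sylow_subgroup_def)
  interpret P: group "G\<lparr>carrier := P\<rparr>" using P by (rule subgroup_imp_group)
  have "x [^]\<^bsub>G\<lparr>carrier := P\<rparr>\<^esub> order (G\<lparr>carrier := P\<rparr>) = \<one>"
    using P.pow_order_eq_1[of x] assms(2) by simp
  then show ?thesis using card by (simp add: order_def flip: nat_pow_consistent)
qed

lemma nilpotent_sylows_commute:
  assumes "nilpotent_group G" "sylow_subgroup G p P" "sylow_subgroup G q Q" "p \<noteq> q"
    and "x \<in> P" "y \<in> Q"
  shows "x \<otimes> y = y \<otimes> x"
proof (rule nilpotent_coprime_commute[OF assms(1)])
  show "x \<in> carrier G" "y \<in> carrier G"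
    using assms subgroup.mem_carrier by (auto simp: sylow_subgroup_def)
  show "coprime (p ^ multiplicity p (order G)) (q ^ multiplicity q (order G))"
    using assms by (auto simp: sylow_subgroup_def primes_coprime)
qed (use assms sylow_pow_eq_one in auto)

lemma comm_group_restrict_iff:
  assumes "subgroup H G"
  shows "comm_group (G\<lparr>carrier := H\<rparr>) \<longleftrightarrow> (\<forall>x\<in>H. \<forall>y\<in>H. x \<otimes> y = y \<otimes> x)"
proof
  assume "comm_group (G\<lparr>carrier := H\<rparr>)"
  from comm_groupE(4)[OF this] show "\<forall>x\<in>H. \<forall>y\<in>H. x \<otimes> y = y \<otimes> x" by simp
next
  assume "\<forall>x\<in>H. \<forall>y\<in>H. x \<otimes> y = y \<otimes> x"
  then show "comm_group (G\<lparr>carrier := H\<rparr>)"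
    by (intro group.group_comm_groupI[OF subgroup_imp_group[OF assms]]) simp
qed

text \<open>The centralizer of \<open>Q\<close> contains \<open>Q\<close> itself, since \<open>Q\<close> is abelian, and a Sylow
  subgroup for each other prime, since orders are coprime. Hence it is the whole group.\<close>

lemma abelian_sylow_central:
  assumes fin: "finite (carrier G)" and nil: "nilpotent_group G"
    and Q: "sylow_subgroup G q Q" and "comm_group (G\<lparr>carrier := Q\<rparr>)"
  shows "Q \<subseteq> group_center G"
proof -
  have QG: "subgroup Q G" using Q by (simp add: sylow_subgroup_def)
  let ?C = "{g \<in> carrier G. \<forall>s\<in>Q. g \<otimes> s = s \<otimes> g}"
  have "?C = carrier G"
  proof (rule subgroup_containing_sylows[OF fin centralizer_subgroup])
    fix r :: nat assume "prime r"
    show "\<exists>R \<subseteq> ?C. sylow_subgroup G r R"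
    proof (cases "r = q")
      case True
      then have "Q \<subseteq> ?C"
        using assms(4) comm_group_restrict_iff[OF QG] subgroup.mem_carrier[OF QG] by blast
      then show ?thesis using Q True by blast
    next
      case False
      obtain R where R: "sylow_subgroup G r R"
        using sylow_subgroup_exists[OF fin \<open>prime r\<close>] by blast
      then have "R \<subseteq> carrier G" by (simp add: sylow_subgroup_def subgroup.subset)
      then have "R \<subseteq> ?C" using nilpotent_sylows_commute[OF nil R Q False] by blast
      then show ?thesis using R by blast
    qed
  qed (use subgroup.subset[OF QG] in auto)
  then have "carrier G \<subseteq> ?C" by (rule equalityD2)
  then have "g \<otimes> s = s \<otimes> g" if "g \<in> carrier G" "s \<in> Q" for g s using that by blast
  then show ?thesis
    using subgroup.mem_carrier[OF QG] unfolding group_center_def by blast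
qed

lemma nilpotent_unique_nonabelian_sylow:
  assumes fin: "finite (carrier G)" and nil: "nilpotent_group G"
    and P: "sylow_subgroup G p P" and nonab: "\<not> comm_group (G\<lparr>carrier := P\<rparr>)"
    and ab: "\<And>q Q. sylow_subgroup G q Q \<Longrightarrow> Q \<noteq> P \<Longrightarrow> comm_group (G\<lparr>carrier := Q\<rparr>)"
  shows "group_center G <#> P = carrier G"
proof -
  have PG: "subgroup P G" using P by (simp add: sylow_subgroup_def)
  interpret Z: normal "group_center G" G by (rule group_center_normal)
  interpret ZP: second_isomorphism_grp "group_center G" G P
    using PG by (intro second_isomorphism_grp.intro second_isomorphism_grp_axioms.intro Z.normal_axioms)
  show ?thesis
  proof (rule subgroup_containing_sylows[OF fin ZP.normal_set_mult_subgroup])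
    fix q :: nat assume "prime q"
    show "\<exists>Q \<subseteq> group_center G <#> P. sylow_subgroup G q Q"
    proof (cases "q = p")
      case True
      then show ?thesis using P ZP.S_contained_in_set_mult by blast
    next
      case False
      obtain Q where Q: "sylow_subgroup G q Q"
        using sylow_subgroup_exists[OF fin \<open>prime q\<close>] by blast
      (* Elements of Q and P commute with each other, so Q = P would make P abelian. *)
      have "Q \<noteq> P"
        using nilpotent_sylows_commute[OF nil Q P False] nonab comm_group_restrict_iff[OF PG]
        by blast
      then have "Q \<subseteq> group_center G"
        using abelian_sylow_central[OF fin nil Q] ab[OF Q] by blast
      then show ?thesis using Q ZP.H_contained_in_set_mult by blast
    qed
  qed
qed

section \<open>Adjacency of conjugacy classes\<close>

lemma comm_group_subgroup_generated_pair:
  assumes a: "a \<in> carrier G" and b: "b \<in> carrier G"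
  shows "comm_group (subgroup_generated G {a, b}) \<longleftrightarrow> a \<otimes> b = b \<otimes> a"
proof
  assume L: "comm_group (subgroup_generated G {a, b})"
  have "a \<in> carrier (subgroup_generated G {a, b})" "b \<in> carrier (subgroup_generated G {a, b})"
    using subgroup_generated_subset_carrier_subset[of "{a, b}"] assms by simp_all
  then show "a \<otimes> b = b \<otimes> a" using comm_groupE(4)[OF L] by simp
next
  assume ab: "a \<otimes> b = b \<otimes> a"
  let ?H = "carrier (subgroup_generated G {a, b})"
  let ?C = "\<lambda>S. {g \<in> carrier G. \<forall>s\<in>S. g \<otimes> s = s \<otimes> g}"
  (* The generated subgroup centralizes a and b; so a and b centralize it, and then so does
     everything that they generate. *)
  have "subgroup (?C {a, b}) G" using assms by (intro centralizer_subgroup) simp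
  then have "?H \<subseteq> ?C {a, b}"
    by (rule subgroup_generated_minimal) (use assms ab in simp)
  then have "{a, b} \<subseteq> ?C ?H" using assms by auto
  moreover have "subgroup (?C ?H) G"
    by (rule centralizer_subgroup) (use \<open>?H \<subseteq> ?C {a, b}\<close> in blast)
  ultimately have "?H \<subseteq> ?C ?H" by (rule subgroup_generated_minimal[rotated])
  then have "x \<otimes> y = y \<otimes> x" if "x \<in> ?H" "y \<in> ?H" for x y using that by blast
  then show "comm_group (subgroup_generated G {a, b})"
    by (intro group.group_comm_groupI[OF group_subgroup_generated]) simp
qed

lemma conj_class_subset: "x \<in> carrier G \<Longrightarrow> conj_class G x \<subseteq> carrier G"
  by (auto simp: conj_class_def)

lemma conj_class_self: "x \<in> carrier G \<Longrightarrow> x \<in> conj_class G x"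
  by (auto simp: conj_class_def intro!: exI[of _ "\<one>"])

lemma pverts_ccc_graph:
  "pverts (ccc_graph G) = conj_class G ` (carrier G - group_center G)"
  by (auto simp: ccc_graph_def Let_def)

text \<open>Closed adjacency (equal or adjacent) is handier than adjacency: a class meets itself in
  commuting elements, so the condition that the vertices be distinct disappears.\<close>

lemma ccc_graph_closed_adjacency:
  assumes "A \<in> pverts (ccc_graph G)" "B \<in> pverts (ccc_graph G)"
  shows "A = B \<or> (A, B) \<in> parcs (ccc_graph G) \<longleftrightarrow> (\<exists>a\<in>A. \<exists>b\<in>B. a \<otimes> b = b \<otimes> a)"
proof -
  have sub: "A \<subseteq> carrier G" "B \<subseteq> carrier G"
    using assms conj_class_subset by (auto simp: pverts_ccc_graph)
  have "(A, B) \<in> parcs (ccc_graph G) \<longleftrightarrow>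
      A \<noteq> B \<and> (\<exists>a\<in>A. \<exists>b\<in>B. comm_group (subgroup_generated G {a, b}))"
    using assms by (simp add: ccc_graph_def Let_def)
  also have "\<dots> \<longleftrightarrow> A \<noteq> B \<and> (\<exists>a\<in>A. \<exists>b\<in>B. a \<otimes> b = b \<otimes> a)"
    using sub comm_group_subgroup_generated_pair by (meson subsetD)
  finally show ?thesis
    using assms conj_class_self by (fastforce simp: pverts_ccc_graph)
qed

text \<open>The central factor of a conjugating element cancels, so conjugating by all of
  \<open>G\<close> is conjugating by \<open>P\<close>, and the central factor \<open>z\<close> stays in front.\<close>

lemma conj_class_central_mult:
  assumes P: "subgroup P G" and ZP: "group_center G <#> P = carrier G"
    and x: "x \<in> P" and z: "z \<in> group_center G"
  shows "conj_class G (z \<otimes> x) = (\<lambda>c. z \<otimes> c) ` conj_class (G\<lparr>carrier := P\<rparr>) x"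
proof -
  interpret P: subgroup P G by (rule P)
  have xc: "x \<in> carrier G" using x by simp
  have zc: "z \<in> carrier G" using z by (simp add: group_center_def)
  have key: "inv (w \<otimes> h) \<otimes> (z \<otimes> x) \<otimes> (w \<otimes> h) = z \<otimes> (inv h \<otimes> x \<otimes> h)"
    if w: "w \<in> group_center G" and h: "h \<in> carrier G" for w h
  proof -
    have wc: "w \<in> carrier G" using w by (simp add: group_center_def)
    have wcomm: "(z \<otimes> x) \<otimes> w = w \<otimes> (z \<otimes> x)" using w zc xc by (simp add: group_center_def)
    have zcomm: "inv h \<otimes> z = z \<otimes> inv h" using z h by (simp add: group_center_def)
    have "inv (w \<otimes> h) \<otimes> (z \<otimes> x) \<otimes> (w \<otimes> h) = inv h \<otimes> inv w \<otimes> ((z \<otimes> x) \<otimes> w) \<otimes> h"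
      using wc h zc xc by (simp add: inv_mult_group m_assoc)
    also have "\<dots> = inv h \<otimes> ((inv w \<otimes> w) \<otimes> (z \<otimes> x)) \<otimes> h"
      unfolding wcomm using wc h zc xc by (simp add: m_assoc inv_mult_cancel_left)
    also have "\<dots> = (inv h \<otimes> z) \<otimes> x \<otimes> h" using wc h zc xc by (simp add: m_assoc)
    also have "\<dots> = z \<otimes> (inv h \<otimes> x \<otimes> h)" unfolding zcomm using h zc xc by (simp add: m_assoc)
    finally show ?thesis .
  qed
  have conjP: "conj_class (G\<lparr>carrier := P\<rparr>) x = (\<lambda>h. inv h \<otimes> x \<otimes> h) ` P"
    using P by (simp add: conj_class_def Setcompr_eq_image cong: image_cong_simp)
  have one: "\<one> \<in> group_center G" by (simp add: group_center_def)
  show ?thesis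
  proof (intro equalityI subsetI)
    fix u assume "u \<in> conj_class G (z \<otimes> x)"
    then obtain g where g: "g \<in> carrier G" and u: "u = inv g \<otimes> (z \<otimes> x) \<otimes> g"
      by (auto simp: conj_class_def)
    from g obtain w h where w: "w \<in> group_center G" and h: "h \<in> P" and gwh: "g = w \<otimes> h"
      unfolding ZP[symmetric] set_mult_def by blast
    have "u = z \<otimes> (inv h \<otimes> x \<otimes> h)"
      unfolding u gwh by (rule key[OF w]) (use h in simp)
    then show "u \<in> (\<lambda>c. z \<otimes> c) ` conj_class (G\<lparr>carrier := P\<rparr>) x"
      using h unfolding conjP by blast
  next
    fix u assume "u \<in> (\<lambda>c. z \<otimes> c) ` conj_class (G\<lparr>carrier := P\<rparr>) x"
    then obtain h where h: "h \<in> P" and u: "u = z \<otimes> (inv h \<otimes> x \<otimes> h)" by (auto simp: conjP)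
    have "u = inv h \<otimes> (z \<otimes> x) \<otimes> h" using key[OF one, of h] h by (simp add: u)
    then show "u \<in> conj_class G (z \<otimes> x)" unfolding conj_class_def using P.subset h by blast
  qed
qed

lemma central_mult_commute_iff:
  assumes "z \<in> group_center G" "w \<in> group_center G" "a \<in> carrier G" "b \<in> carrier G"
  shows "(z \<otimes> a) \<otimes> (w \<otimes> b) = (w \<otimes> b) \<otimes> (z \<otimes> a) \<longleftrightarrow> a \<otimes> b = b \<otimes> a"
proof -
  have c: "z \<in> carrier G" "w \<in> carrier G" using assms by (auto simp: group_center_def)
  have "(z \<otimes> a) \<otimes> (w \<otimes> b) = z \<otimes> (a \<otimes> w) \<otimes> b" using assms c by (simp add: m_assoc)
  also have "a \<otimes> w = w \<otimes> a" using assms(2,3) unfolding group_center_def by blast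
  finally have 1: "(z \<otimes> a) \<otimes> (w \<otimes> b) = (z \<otimes> w) \<otimes> (a \<otimes> b)" using assms c by (simp add: m_assoc)
  have "(w \<otimes> b) \<otimes> (z \<otimes> a) = w \<otimes> (b \<otimes> z) \<otimes> a" using assms c by (simp add: m_assoc)
  also have "b \<otimes> z = z \<otimes> b" using assms(1,4) unfolding group_center_def by blast
  finally have "(w \<otimes> b) \<otimes> (z \<otimes> a) = (w \<otimes> z) \<otimes> (b \<otimes> a)" using assms c by (simp add: m_assoc)
  also have "w \<otimes> z = z \<otimes> w" using assms(1) c(2) unfolding group_center_def by blast
  finally show ?thesis unfolding 1 using assms c by simp
qed

text \<open>The projection sends \<open>z D\<close> to \<open>D\<close>. A class may have several such decompositions, with
  different \<open>D\<close>; any choice satisfies the stated equivalence, so one is picked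
  for each class.\<close>

lemma ccc_graph_projection:
  assumes P: "subgroup P G" and ZP: "group_center G <#> P = carrier G"
  obtains \<pi> where "\<pi> ` pverts (ccc_graph G) \<subseteq> pverts (ccc_graph (G\<lparr>carrier := P\<rparr>))"
    and "\<And>A B. A \<in> pverts (ccc_graph G) \<Longrightarrow> B \<in> pverts (ccc_graph G) \<Longrightarrow>
      (A = B \<or> (A, B) \<in> parcs (ccc_graph G)) \<longleftrightarrow>
      (\<pi> A = \<pi> B \<or> (\<pi> A, \<pi> B) \<in> parcs (ccc_graph (G\<lparr>carrier := P\<rparr>)))"
proof -
  let ?P = "G\<lparr>carrier := P\<rparr>"
  interpret P: group ?P using P by (rule subgroup_imp_group)
  have PG: "P \<subseteq> carrier G" using P by (rule subgroup.subset)
  have "\<exists>D. D \<in> pverts (ccc_graph ?P) \<and> (\<exists>z \<in> group_center G. C = (\<lambda>c. z \<otimes> c) ` D)"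
    if C: "C \<in> pverts (ccc_graph G)" for C
  proof -
    obtain g where g: "g \<in> carrier G" "g \<notin> group_center G" "C = conj_class G g"
      using C by (auto simp: pverts_ccc_graph)
    from g(1) obtain z x where z: "z \<in> group_center G" and x: "x \<in> P" and gzx: "g = z \<otimes> x"
      unfolding ZP[symmetric] set_mult_def by blast
    have zc: "z \<in> carrier G" using z by (simp add: group_center_def)
    \<comment> \<open>An element central in \<open>P\<close> commutes with \<open>Z(G) P = G\<close>, and so would \<open>g\<close>.\<close>
    have "x \<notin> group_center ?P"
    proof
      assume xZ: "x \<in> group_center ?P"
      have "k \<otimes> g = g \<otimes> k" if "k \<in> carrier G" for k
      proof -
        from that obtain w h where w: "w \<in> group_center G" and h: "h \<in> P" and k: "k = w \<otimes> h"
          unfolding ZP[symmetric] set_mult_def by blast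
        have "h \<otimes> x = x \<otimes> h" using xZ h by (simp add: group_center_def)
        then show ?thesis
          using central_mult_commute_iff[OF w z, of h x] h x PG by (auto simp: k gzx)
      qed
      then show False using g by (simp add: group_center_def)
    qed
    then have "conj_class ?P x \<in> pverts (ccc_graph ?P)" using x by (auto simp: P.pverts_ccc_graph)
    then show ?thesis using conj_class_central_mult[OF P ZP x z] g(3) gzx z by blast
  qed
  then have "\<forall>C \<in> pverts (ccc_graph G). \<exists>D. D \<in> pverts (ccc_graph ?P) \<and>
      (\<exists>z \<in> group_center G. C = (\<lambda>c. z \<otimes> c) ` D)" by blast
  from bchoice[OF this] obtain \<pi> where
    "\<forall>C \<in> pverts (ccc_graph G). \<pi> C \<in> pverts (ccc_graph ?P) \<and>
      (\<exists>z \<in> group_center G. C = (\<lambda>c. z \<otimes> c) ` \<pi> C)" by blast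
  note \<pi> = this[rule_format]
  show thesis
  proof (rule that)
    show "\<pi> ` pverts (ccc_graph G) \<subseteq> pverts (ccc_graph ?P)" using \<pi> by blast
    fix A B assume A: "A \<in> pverts (ccc_graph G)" and B: "B \<in> pverts (ccc_graph G)"
    define D E where "D = \<pi> A" and "E = \<pi> B"
    have D: "D \<in> pverts (ccc_graph ?P)" and E: "E \<in> pverts (ccc_graph ?P)"
      using \<pi>[OF A] \<pi>[OF B] by (simp_all add: D_def E_def)
    obtain z where z: "z \<in> group_center G" and Az: "A = (\<lambda>c. z \<otimes> c) ` D"
      using \<pi>[OF A, folded D_def] by (elim conjE bexE) (rule that)
    obtain w where w: "w \<in> group_center G" and Bw: "B = (\<lambda>c. w \<otimes> c) ` E"
      using \<pi>[OF B, folded E_def] by (elim conjE bexE) (rule that)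
    have sub: "F \<subseteq> carrier G" if F: "F \<in> pverts (ccc_graph ?P)" for F
    proof -
      obtain x where "x \<in> carrier ?P" "F = conj_class ?P x"
        using F unfolding P.pverts_ccc_graph by blast
      then show ?thesis using P.conj_class_subset[of x] PG by simp
    qed
    have "(A = B \<or> (A, B) \<in> parcs (ccc_graph G)) \<longleftrightarrow> (\<exists>a\<in>A. \<exists>b\<in>B. a \<otimes> b = b \<otimes> a)"
      using A B by (rule ccc_graph_closed_adjacency)
    also have "\<dots> \<longleftrightarrow> (\<exists>a\<in>D. \<exists>b\<in>E. (z \<otimes> a) \<otimes> (w \<otimes> b) = (w \<otimes> b) \<otimes> (z \<otimes> a))"
      unfolding Az Bw bex_simps ..
    also have "\<dots> \<longleftrightarrow> (\<exists>a\<in>D. \<exists>b\<in>E. a \<otimes> b = b \<otimes> a)"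
      using sub[OF D] sub[OF E] central_mult_commute_iff[OF z w] by (intro bex_cong refl) blast
    also have "\<dots> \<longleftrightarrow> (\<pi> A = \<pi> B \<or> (\<pi> A, \<pi> B) \<in> parcs (ccc_graph ?P))"
      using P.ccc_graph_closed_adjacency[OF D E] by (simp add: D_def E_def)
    finally show "(A = B \<or> (A, B) \<in> parcs (ccc_graph G)) \<longleftrightarrow>
      (\<pi> A = \<pi> B \<or> (\<pi> A, \<pi> B) \<in> parcs (ccc_graph ?P))" .
  qed
qed

end

section \<open>Induced subgraphs without twins\<close>

text \<open>Distinct vertices with the same closed neighbourhood, i.e. adjacent twins, are excluded;
  non-adjacent twins are allowed, and the cycle of length four has some.\<close>

definition twin_free :: "'v pair_pre_digraph \<Rightarrow> bool" where
  "twin_free H \<longleftrightarrow> (\<forall>u \<in> pverts H. \<forall>v \<in> pverts H.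
     (\<forall>w \<in> pverts H. (u = w \<or> (u, w) \<in> parcs H) \<longleftrightarrow> (v = w \<or> (v, w) \<in> parcs H)) \<longrightarrow> u = v)"

text \<open>Vertices of an induced copy of \<open>H\<close> with equal images under \<open>\<pi>\<close> have the same closed
  neighbourhood within the copy. Absence of such vertices in \<open>H\<close> makes \<open>\<pi>\<close> injective
  on the copy, and then closed adjacency determines adjacency.\<close>

lemma contains_induced_projection:
  assumes H: "pair_graph H" and \<Gamma>: "pair_graph \<Gamma>" and \<Delta>: "pair_graph \<Delta>" and tf: "twin_free H"
    and im: "\<pi> ` pverts \<Gamma> \<subseteq> pverts \<Delta>"
    and adj: "\<And>A B. A \<in> pverts \<Gamma> \<Longrightarrow> B \<in> pverts \<Gamma> \<Longrightarrow>
      (A = B \<or> (A, B) \<in> parcs \<Gamma>) \<longleftrightarrow> (\<pi> A = \<pi> B \<or> (\<pi> A, \<pi> B) \<in> parcs \<Delta>)"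
    and ind: "contains_induced \<Gamma> H"
  shows "contains_induced \<Delta> H"
proof -
  interpret H: pair_graph H by (rule H)
  interpret \<Gamma>: pair_graph \<Gamma> by (rule \<Gamma>)
  interpret \<Delta>: pair_graph \<Delta> by (rule \<Delta>)
  have wf: "pair_wf_digraph H" by (rule H.pair_wf_digraph_axioms)
  obtain f where inj: "inj_on f (pverts H)" and sub: "f ` pverts H \<subseteq> pverts \<Gamma>"
    and f: "\<And>u v. u \<in> pverts H \<Longrightarrow> v \<in> pverts H \<Longrightarrow>
      (u, v) \<in> parcs H \<longleftrightarrow> (f u, f v) \<in> parcs \<Gamma>"
    using ind unfolding contains_induced_iff[OF wf] by blast
  let ?g = "\<lambda>u. \<pi> (f u)"
  have loopfree: "(u, u) \<notin> parcs H" "(D, D) \<notin> parcs \<Delta>" for u D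
    using H.no_loops' \<Delta>.no_loops' by blast+
  have g: "(u = v \<or> (u, v) \<in> parcs H) \<longleftrightarrow> (?g u = ?g v \<or> (?g u, ?g v) \<in> parcs \<Delta>)"
    if "u \<in> pverts H" "v \<in> pverts H" for u v
  proof -
    have "f u \<in> pverts \<Gamma>" "f v \<in> pverts \<Gamma>" using sub that by blast+
    moreover have "u = v \<longleftrightarrow> f u = f v" using inj_on_eq_iff[OF inj that] by simp
    ultimately show ?thesis by (simp only: f[OF that] adj)
  qed
  have injg: "inj_on ?g (pverts H)"
  proof (rule inj_onI)
    fix u v assume uv: "u \<in> pverts H" "v \<in> pverts H" "?g u = ?g v"
    then have "\<forall>w \<in> pverts H. (u = w \<or> (u, w) \<in> parcs H) \<longleftrightarrow> (v = w \<or> (v, w) \<in> parcs H)"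
      using g by simp
    then show "u = v" using tf uv(1,2) unfolding twin_free_def by blast
  qed
  have "(u, v) \<in> parcs H \<longleftrightarrow> (?g u, ?g v) \<in> parcs \<Delta>"
    if "u \<in> pverts H" "v \<in> pverts H" for u v
    using g[OF that] inj_onD[OF injg _ that] loopfree by metis
  moreover have "?g ` pverts H \<subseteq> pverts \<Delta>" using im sub by blast
  ultimately show ?thesis
    unfolding contains_induced_iff[OF wf] using injg by blast
qed

lemma contains_induced_pverts_empty:
  assumes "pair_graph H" "contains_induced \<Gamma> H" "pverts \<Gamma> = {}"
  shows "pverts H = {}"
proof -
  interpret H: pair_graph H by (rule assms(1))
  obtain f where "f ` pverts H \<subseteq> pverts \<Gamma>"
    using assms(2) unfolding contains_induced_iff[OF H.pair_wf_digraph_axioms] by blast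
  then show ?thesis by (simp add: assms(3))
qed

lemma twin_free_path_graph_4: "twin_free (path_graph 4)"
proof -
  have "{..<4} = {0, 1, 2, 3::nat}" by auto
  then show ?thesis by (simp add: twin_free_def path_graph_def)
qed

lemma twin_free_cycle_graph:
  assumes n: "n \<ge> 4"
  shows "twin_free (cycle_graph n)"
  unfolding twin_free_def
proof (intro ballI impI)
  fix u v assume uv: "u \<in> pverts (cycle_graph n)" "v \<in> pverts (cycle_graph n)"
  then have un: "u < n" and vn: "v < n" by (auto simp: cycle_graph_def)
  assume "\<forall>w \<in> pverts (cycle_graph n). (u = w \<or> (u, w) \<in> parcs (cycle_graph n)) \<longleftrightarrow>
    (v = w \<or> (v, w) \<in> parcs (cycle_graph n))"
  then have nb: "(u = w \<or> w = Suc u mod n \<or> u = Suc w mod n) \<longleftrightarrow>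
      (v = w \<or> w = Suc v mod n \<or> v = Suc w mod n)" if "w < n" for w
    using that un vn by (simp add: cycle_graph_def)
  (* The vertex two steps ahead of k is adjacent to the successor of k but not to k;
     for n = 3 it would precede k. *)
  have two_steps: "Suc (Suc k mod n) mod n < n \<and> k \<noteq> Suc (Suc k mod n) mod n \<and>
      Suc (Suc k mod n) mod n \<noteq> Suc k mod n \<and> k \<noteq> Suc (Suc (Suc k mod n) mod n) mod n"
    if "k < n" for k
  proof -
    have "k + 3 < n \<or> n = k + 3 \<or> n = k + 2 \<or> n = k + 1" using that by arith
    then show ?thesis using n by (elim disjE) (auto simp: mod_Suc)
  qed
  show "u = v"
  proof (rule ccontr)
    assume "u \<noteq> v"
    then consider "v = Suc u mod n" | "u = Suc v mod n" using nb[OF un] by blast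
    then show False
    proof cases
      case 1
      then show False using nb[of "Suc v mod n"] two_steps[OF un, folded 1] by blast
    next
      case 2
      then show False using nb[of "Suc u mod n"] two_steps[OF vn, folded 2] by blast
    qed
  qed
qed

theorem theorem2p3:
  fixes G :: "('a, 'b) monoid_scheme"
  assumes "group G" and "finite (carrier G)" and "nilpotent_group G"
    and "\<And>p. \<not> p_group p G"
    and "comm_group G \<or>
      (\<not> comm_group G \<and>
       (\<exists>p P. sylow_subgroup G p P \<and> \<not> comm_group (G\<lparr>carrier := P\<rparr>) \<and>
          (\<forall>q Q. sylow_subgroup G q Q \<and> Q \<noteq> P \<longrightarrow> comm_group (G\<lparr>carrier := Q\<rparr>)) \<and>
          cograph (ccc_graph (G\<lparr>carrier := P\<rparr>)) \<and> chordal (ccc_graph (G\<lparr>carrier := P\<rparr>))))"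
  shows "cograph (ccc_graph G) \<and> chordal (ccc_graph G)"
proof -
  interpret group G by (rule assms(1))
  show ?thesis
  proof (cases "comm_group G")
    case True
    then have "group_center G = carrier G"
      using comm_groupE(4)[OF True] unfolding group_center_def by blast
    then have "pverts (ccc_graph G) = {}" by (simp add: pverts_ccc_graph)
    then have empty: "pverts H = {}" if "pair_graph H" "contains_induced (ccc_graph G) H"
      for H :: "nat pair_pre_digraph"
      using contains_induced_pverts_empty that by blast
    have "0 \<in> pverts (path_graph 4)" by (simp add: path_graph_def)
    then have "cograph (ccc_graph G)"
      unfolding cograph_def using empty[OF pair_graph_path_graph] by blast
    moreover have "chordal (ccc_graph G)"
      unfolding chordal_def
    proof (intro allI impI notI)
      fix n :: nat assume "n \<ge> 4" and "contains_induced (ccc_graph G) (cycle_graph n)"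
      then have "pverts (cycle_graph n) = {}" by (intro empty pair_graph_cycle_graph) simp_all
      moreover have "0 \<in> pverts (cycle_graph n)"
        using \<open>n \<ge> 4\<close> by (simp add: cycle_graph_def)
      ultimately show False by blast
    qed
    ultimately show ?thesis by blast
  next
    case False
    then obtain p P where P: "sylow_subgroup G p P" "\<not> comm_group (G\<lparr>carrier := P\<rparr>)"
      and ab: "\<And>q Q. sylow_subgroup G q Q \<Longrightarrow> Q \<noteq> P \<Longrightarrow> comm_group (G\<lparr>carrier := Q\<rparr>)"
      and co: "cograph (ccc_graph (G\<lparr>carrier := P\<rparr>))"
      and ch: "chordal (ccc_graph (G\<lparr>carrier := P\<rparr>))"
      using assms(5) by blast
    have PG: "subgroup P G" using P by (simp add: sylow_subgroup_def)
    have "finite P" using subgroup.subset[OF PG] assms(2) finite_subset by blast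
    then have graphs: "pair_graph (ccc_graph G)" "pair_graph (ccc_graph (G\<lparr>carrier := P\<rparr>))"
      using assms(2) by (simp_all add: pair_graph_ccc_graph)
    have "group_center G <#>\<^bsub>G\<^esub> P = carrier G"
      using nilpotent_unique_nonabelian_sylow[OF assms(2,3) P] ab by blast
    then obtain \<pi> where \<pi>: "\<pi> ` pverts (ccc_graph G) \<subseteq> pverts (ccc_graph (G\<lparr>carrier := P\<rparr>))"
      "\<And>A B. A \<in> pverts (ccc_graph G) \<Longrightarrow> B \<in> pverts (ccc_graph G) \<Longrightarrow>
        (A = B \<or> (A, B) \<in> parcs (ccc_graph G)) \<longleftrightarrow>
        (\<pi> A = \<pi> B \<or> (\<pi> A, \<pi> B) \<in> parcs (ccc_graph (G\<lparr>carrier := P\<rparr>)))"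
      using ccc_graph_projection[OF PG] by blast
    have transfer: "contains_induced (ccc_graph (G\<lparr>carrier := P\<rparr>)) H"
      if "pair_graph H" "twin_free H" "contains_induced (ccc_graph G) H" for H :: "nat pair_pre_digraph"
      using contains_induced_projection[OF that(1) graphs that(2) \<pi> that(3)] by blast
    have "cograph (ccc_graph G)"
      using co transfer[OF pair_graph_path_graph twin_free_path_graph_4]
      unfolding cograph_def by blast
    moreover have "chordal (ccc_graph G)"
      unfolding chordal_def
    proof (intro allI impI notI)
      fix n :: nat assume n: "n \<ge> 4" and "contains_induced (ccc_graph G) (cycle_graph n)"
      then have "contains_induced (ccc_graph (G\<lparr>carrier := P\<rparr>)) (cycle_graph n)"
        by (intro transfer pair_graph_cycle_graph twin_free_cycle_graph) simp_all
      then show False using ch n unfolding chordal_def by blast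
    qed
    ultimately show ?thesis by blast
  qed
qed

end
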